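(* Every connected locally connected $\{K_{1,1,3},K_1+P_4\}$-free graph of order at least $3$ is fully cycle extendable.
   Context: All graphs are finite, simple, and undirected. $n(G)$ is the order of $G$; $N_G(u)$ is the (open) neighborhood of $u$ in $G$. $G$ is locally connected if for every vertex $u$ of $G$ the induced subgraph $G[N_G(u)]$ is connected. $G+H$ denotes the join of disjoint graphs (all edges between them are added to their disjoint union); $K_n$ and $P_n$ are the complete graph and the path of order $n$, $\bar{G}$ is the complement of $G$, and $K_{1,1,3}=K_1+K_1+\bar{K}_3$. For a set ${\cal F}$ of graphs, a graph is ${\cal F}$-free if it contains no graph in ${\cal F}$ as an induced subgraph (up to isomorphism). A cycle $C$ in $G$ is extendable if $G$ contains a cycle $C'$ of order $n(C)+1$ with $V(C)\subseteq V(C')$. $G$ is fully cycle extendable if every vertex of $G$ lies on a triangle and every cycle in $G$ of order less than $n(G)$ is extendable. *)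

theory Defs
  imports
    "Graph_Theory.Pair_Digraph"
    "Graph_Theory.Digraph_Component"
    "Graph_Theory.Digraph_Isomorphism"
    "Graph_Theory.Vertex_Walk"
begin

text \<open>
  A finite simple undirected graph is a \<^locale>\<open>pair_graph\<close>: a finite, loop-free, symmetric
  digraph whose arcs are pairs of vertices, so an edge \<open>uv\<close> is the pair of arcs \<open>(u, v)\<close>, \<open>(v, u)\<close>.
\<close>

definition nbhd :: "'a pair_pre_digraph \<Rightarrow> 'a \<Rightarrow> 'a set" where
  "nbhd G u = {v. (u, v) \<in> parcs G}"

text \<open>
  The library's \<^const>\<open>Digraph_Component.connected\<close> excludes the null graph, so an isolated
  vertex violates local connectedness; a connected graph of order at least 2 has none.
\<close>

definition locally_connected :: "'a pair_pre_digraph \<Rightarrow> bool" where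
  "locally_connected G \<longleftrightarrow>
     (\<forall>u \<in> pverts G. Digraph_Component.connected (with_proj G \<restriction> nbhd G u))"

definition complete_graph :: "'a set \<Rightarrow> 'a pair_pre_digraph" where
  "complete_graph V = \<lparr>pverts = V, parcs = {(u, v). u \<in> V \<and> v \<in> V \<and> u \<noteq> v}\<rparr>"

definition path_graph :: "'a list \<Rightarrow> 'a pair_pre_digraph" where
  "path_graph vs = \<lparr>pverts = set vs, parcs = set (vwalk_arcs vs) \<union> (set (vwalk_arcs vs))\<inverse>\<rparr>"

definition graph_complement :: "'a pair_pre_digraph \<Rightarrow> 'a pair_pre_digraph" where
  "graph_complement G =
     \<lparr>pverts = pverts G,
      parcs = {(u, v). u \<in> pverts G \<and> v \<in> pverts G \<and> u \<noteq> v \<and> (u, v) \<notin> parcs G}\<rparr>"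

text \<open>The join is meant for graphs with disjoint vertex sets only.\<close>

definition graph_join :: "'a pair_pre_digraph \<Rightarrow> 'a pair_pre_digraph \<Rightarrow> 'a pair_pre_digraph" where
  "graph_join G H =
     \<lparr>pverts = pverts G \<union> pverts H,
      parcs = parcs G \<union> parcs H \<union> pverts G \<times> pverts H \<union> pverts H \<times> pverts G\<rparr>"

definition K113 :: "nat pair_pre_digraph" where
  "K113 = graph_join (graph_join (complete_graph {0}) (complete_graph {1}))
                     (graph_complement (complete_graph {2, 3, 4}))"

definition K1_join_P4 :: "nat pair_pre_digraph" where
  "K1_join_P4 = graph_join (complete_graph {0}) (path_graph [1, 2, 3, 4])"

definition induced_free :: "'b pair_pre_digraph set \<Rightarrow> 'a pair_pre_digraph \<Rightarrow> bool" where
  "induced_free \<F> G \<longleftrightarrow>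
     \<not> (\<exists>F \<in> \<F>. \<exists>H. induced_subgraph H (with_proj G) \<and> digraph_iso (with_proj F) H)"

text \<open>
  A cycle is the list of its arcs in one of the two directions, with some starting point. The
  length bound is needed because \<^const>\<open>pre_digraph.cycle\<close> also admits \<open>[(u, v), (v, u)]\<close>,
  which is not a cycle of an undirected graph.
\<close>

definition graph_cycle :: "'a pair_pre_digraph \<Rightarrow> ('a \<times> 'a) awalk \<Rightarrow> bool" where
  "graph_cycle G C \<longleftrightarrow> pre_digraph.cycle (with_proj G) C \<and> 3 \<le> length C"

definition cycle_verts :: "('a \<times> 'a) awalk \<Rightarrow> 'a set" where
  "cycle_verts C = fst ` set C"

definition extendable :: "'a pair_pre_digraph \<Rightarrow> ('a \<times> 'a) awalk \<Rightarrow> bool" where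
  "extendable G C \<longleftrightarrow>
     (\<exists>C'. graph_cycle G C' \<and> card (cycle_verts C') = card (cycle_verts C) + 1 \<and>
           cycle_verts C \<subseteq> cycle_verts C')"

definition fully_cycle_extendable :: "'a pair_pre_digraph \<Rightarrow> bool" where
  "fully_cycle_extendable G \<longleftrightarrow>
     (\<forall>u \<in> pverts G. \<exists>T. graph_cycle G T \<and> card (cycle_verts T) = 3 \<and> u \<in> cycle_verts T) \<and>
     (\<forall>C. graph_cycle G C \<and> card (cycle_verts C) < card (pverts G) \<longrightarrow> extendable G C)"

end

theory Submission
  imports Defs
begin

text \<open>
  Suppose a cycle \<open>C\<close> is not extendable, let \<open>u\<close> be a vertex of \<open>C\<close> with a neighbour \<open>x\<close> off \<open>C\<close>,
  and write \<open>v\<^sup>+\<close> for the successor of \<open>v\<close> on \<open>C\<close>. Two nonadjacent vertices of a connected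
  \<open>P\<^sub>4\<close>-free graph have a common neighbour, so \<open>x\<close> and \<open>u\<^sup>+\<close> have a common neighbour \<open>y\<close> in
  \<open>N(u)\<close>, which must lie on \<open>C\<close>. Inserting \<open>x\<close> after \<open>u\<close> or \<open>y\<close>, or rerouting \<open>C\<close> through \<open>u x y\<close>
  and \<open>u\<^sup>+ y\<^sup>+\<close>, would extend \<open>C\<close>, so \<open>x, u\<^sup>+, y\<^sup>+\<close> are independent. If \<open>u\<close> and \<open>y\<^sup>+\<close> were
  adjacent, the edge \<open>u y\<close> and these three vertices would induce \<open>K\<^sub>1\<^sub>,\<^sub>1\<^sub>,\<^sub>3\<close>. Let \<open>w\<close> be a common
  neighbour of \<open>x\<close> and \<open>y\<^sup>+\<close> in \<open>N(y)\<close>. The paths \<open>u x w y\<^sup>+\<close> and \<open>u\<^sup>+ u w y\<^sup>+\<close> in \<open>N(y)\<close> are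
  not induced, so \<open>w\<close> is adjacent to \<open>u\<close> and then to \<open>u\<^sup>+\<close>. Now the edge \<open>w y\<close> and
  \<open>x, u\<^sup>+, y\<^sup>+\<close> induce \<open>K\<^sub>1\<^sub>,\<^sub>1\<^sub>,\<^sub>3\<close>.
\<close>

section \<open>Forbidden induced subgraphs\<close>

text \<open>The image of \<open>F\<close> under \<open>f\<close>, with arcs mapped by
  \<open>map_prod f f\<close>, is a copy of \<open>F\<close>. Since \<open>f\<close> also reflects
  adjacency, this copy is an induced subgraph of \<open>G\<close>.\<close>

lemma induced_freeD:
  assumes free: "induced_free \<F> G" and "F \<in> \<F>"
    and wf: "pair_wf_digraph F" "pair_wf_digraph G"
    and inj: "inj_on f (pverts F)" and sub: "f ` pverts F \<subseteq> pverts G"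
    and arcs: "\<And>u v. u \<in> pverts F \<Longrightarrow> v \<in> pverts F \<Longrightarrow>
      (u, v) \<in> parcs F \<longleftrightarrow> (f u, f v) \<in> parcs G"
  shows False
proof -
  interpret F: pair_wf_digraph F by fact
  interpret G: pair_wf_digraph G by fact
  define h where "h = \<lparr>iso_verts = f, iso_arcs = map_prod f f, iso_head = snd, iso_tail = fst\<rparr>"
  let ?H = "app_iso h (with_proj F)"
  have "inj_on (map_prod f f) (parcs F)"
    by (rule inj_on_subset[OF map_prod_inj_on[OF inj inj]]) (auto dest: F.wellformed')
  then have iso: "pre_digraph.digraph_isomorphism (with_proj F) h"
    unfolding pre_digraph.digraph_isomorphism_def
    using inj F.wf_digraph_axioms by (auto simp: h_def)
  have "parcs F \<subseteq> pverts F \<times> pverts F"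
    by (auto dest: F.wellformed')
  then have arcs_H: "arcs ?H = {e \<in> parcs G. fst e \<in> verts ?H \<and> snd e \<in> verts ?H}"
    using arcs by (force simp: h_def image_iff)
  have "subgraph ?H (with_proj G)"
    unfolding subgraph_def compatible_def
    using sub arcs_H G.wf_digraph_axioms F.wf_digraphI_app_iso[OF iso] by (auto simp: h_def)
  then have "induced_subgraph ?H (with_proj G)"
    using arcs_H by (simp add: induced_subgraph_def)
  moreover have "digraph_iso (with_proj F) ?H"
    using iso by (auto simp: digraph_iso_def)
  ultimately show False
    using free \<open>F \<in> \<F>\<close> by (auto simp: induced_free_def)
qed

lemma K113_simps:
  "pverts K113 = {0, 1, 2, 3, 4}"
  "parcs K113 = {(0, 1), (1, 0)} \<union> {0, 1} \<times> {2, 3, 4} \<union> {2, 3, 4} \<times> {0, 1}"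
  by (auto simp: K113_def graph_join_def complete_graph_def graph_complement_def)

lemma K1_join_P4_simps:
  "pverts K1_join_P4 = {0, 1, 2, 3, 4}"
  "parcs K1_join_P4 = {(1, 2), (2, 1), (2, 3), (3, 2), (3, 4), (4, 3)} \<union>
     {0} \<times> {1, 2, 3, 4} \<union> {1, 2, 3, 4} \<times> {0}"
  by (auto simp: K1_join_P4_def graph_join_def complete_graph_def path_graph_def)

context pair_graph
begin

lemma no_induced_K113:
  assumes "induced_free \<F> G" "K113 \<in> \<F>"
    and "(p, q) \<in> parcs G" "distinct [a, b, c]"
    and "{a, b, c} \<subseteq> nbhd G p \<inter> nbhd G q"
    and "(a, b) \<notin> parcs G" "(a, c) \<notin> parcs G" "(b, c) \<notin> parcs G"
  shows False
proof -
  have wf: "pair_wf_digraph K113"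
    by unfold_locales (auto simp: K113_simps)
  \<comment> \<open>The two dominating vertices 0, 1 go to \<open>p\<close>, \<open>q\<close>, the
    independent ones 2, 3, 4 to \<open>a\<close>, \<open>b\<close>, \<open>c\<close>.\<close>
  let ?f = "(!) [p, q, a, b, c]"
  have adj: "(p, q) \<in> parcs G" "(q, p) \<in> parcs G" "(p, a) \<in> parcs G"
    "(a, p) \<in> parcs G" "(p, b) \<in> parcs G" "(b, p) \<in> parcs G" "(p, c) \<in> parcs G"
    "(c, p) \<in> parcs G" "(q, a) \<in> parcs G" "(a, q) \<in> parcs G" "(q, b) \<in> parcs G"
    "(b, q) \<in> parcs G" "(q, c) \<in> parcs G" "(c, q) \<in> parcs G"
    "(a, b) \<notin> parcs G" "(b, a) \<notin> parcs G" "(a, c) \<notin> parcs G"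
    "(c, a) \<notin> parcs G" "(b, c) \<notin> parcs G" "(c, b) \<notin> parcs G"
    using assms(3-) arcs_symmetric by (auto simp: nbhd_def)
  have ne: "p \<noteq> q" "p \<noteq> a" "p \<noteq> b" "p \<noteq> c" "q \<noteq> a" "q \<noteq> b" "q \<noteq> c" "a \<noteq> b" "a \<noteq> c" "b \<noteq> c"
    using assms no_loops' by (auto simp: nbhd_def)
  have noloop: "(s, s) \<notin> parcs G" for s
    using no_loops' by blast
  show False
  proof (rule induced_freeD[OF assms(1,2) wf pair_wf_digraph, where f = ?f])
    show "inj_on ?f (pverts K113)"
      using ne by (auto simp: inj_on_def K113_simps)
    show "?f ` pverts K113 \<subseteq> pverts G"
      using assms wellformed' by (auto simp: K113_simps nbhd_def)
    have "\<forall>u \<in> pverts K113. \<forall>v \<in> pverts K113.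
        (u, v) \<in> parcs K113 \<longleftrightarrow> (?f u, ?f v) \<in> parcs G"
      using adj noloop by (simp add: K113_simps)
    then show "(u, v) \<in> parcs K113 \<longleftrightarrow> (?f u, ?f v) \<in> parcs G"
      if "u \<in> pverts K113" "v \<in> pverts K113" for u v
      using that by blast
  qed
qed

lemma no_induced_P4_in_nbhd:
  assumes "induced_free \<F> G" "K1_join_P4 \<in> \<F>"
    and "distinct [a, b, c, d]" "{a, b, c, d} \<subseteq> nbhd G p"
    and "(a, b) \<in> parcs G" "(b, c) \<in> parcs G" "(c, d) \<in> parcs G"
    and "(a, c) \<notin> parcs G" "(a, d) \<notin> parcs G" "(b, d) \<notin> parcs G"
  shows False
proof -
  have wf: "pair_wf_digraph K1_join_P4"
    by unfold_locales (auto simp: K1_join_P4_simps)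
  \<comment> \<open>The apex 0 goes to \<open>p\<close>, the path 1, 2, 3, 4 to \<open>a\<close>,
    \<open>b\<close>, \<open>c\<close>, \<open>d\<close> in this order.\<close>
  let ?f = "(!) [p, a, b, c, d]"
  have adj: "(p, a) \<in> parcs G" "(a, p) \<in> parcs G" "(p, b) \<in> parcs G"
    "(b, p) \<in> parcs G" "(p, c) \<in> parcs G" "(c, p) \<in> parcs G" "(p, d) \<in> parcs G"
    "(d, p) \<in> parcs G" "(a, b) \<in> parcs G" "(b, a) \<in> parcs G" "(b, c) \<in> parcs G"
    "(c, b) \<in> parcs G" "(c, d) \<in> parcs G" "(d, c) \<in> parcs G"
    "(a, c) \<notin> parcs G" "(c, a) \<notin> parcs G" "(a, d) \<notin> parcs G"
    "(d, a) \<notin> parcs G" "(b, d) \<notin> parcs G" "(d, b) \<notin> parcs G"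
    using assms(3-) arcs_symmetric by (auto simp: nbhd_def)
  have noloop: "(s, s) \<notin> parcs G" for s
    using no_loops' by blast
  have ne: "p \<noteq> a" "p \<noteq> b" "p \<noteq> c" "p \<noteq> d"
    using assms noloop by (auto simp: nbhd_def)
  show False
  proof (rule induced_freeD[OF assms(1,2) wf pair_wf_digraph, where f = ?f])
    show "inj_on ?f (pverts K1_join_P4)"
      using ne assms(3) by (auto simp: inj_on_def K1_join_P4_simps)
    show "?f ` pverts K1_join_P4 \<subseteq> pverts G"
      using assms wellformed' by (auto simp: K1_join_P4_simps nbhd_def)
    have "\<forall>u \<in> pverts K1_join_P4. \<forall>v \<in> pverts K1_join_P4.
        (u, v) \<in> parcs K1_join_P4 \<longleftrightarrow> (?f u, ?f v) \<in> parcs G"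
      using adj noloop by (simp add: K1_join_P4_simps)
    then show "(u, v) \<in> parcs K1_join_P4 \<longleftrightarrow> (?f u, ?f v) \<in> parcs G"
      if "u \<in> pverts K1_join_P4" "v \<in> pverts K1_join_P4" for u v
      using that by blast
  qed
qed

end

section \<open>Connectedness\<close>

lemma rtrancl_on_leaves:
  assumes "(u, v) \<in> rtrancl_on V E" "u \<in> S" "v \<notin> S"
  obtains s t where "s \<in> S" "t \<in> V - S" "(s, t) \<in> E"
  using assms by (induction rule: rtrancl_on_induct) blast+

text \<open>A walk from \<open>S\<close> to a vertex outside \<open>S\<close> must cross the
  boundary somewhere. Connectedness refers to the underlying undirected graph, hence the symmetric
  closure.\<close>

lemma connected_leaves:
  assumes "connected H" "S \<subseteq> verts H" "S \<noteq> {}" "S \<noteq> verts H"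
  obtains s t where "s \<in> S" "t \<in> verts H - S" "(s, t) \<in> (arcs_ends H)\<^sup>s"
proof -
  obtain u v where "u \<in> S" "v \<in> verts H - S"
    using assms by blast
  then have "(u, v) \<in> rtrancl_on (verts H) ((arcs_ends H)\<^sup>s)"
    using assms by (auto simp: connected_conv)
  then show thesis
    using \<open>u \<in> S\<close> \<open>v \<in> verts H - S\<close> that by (auto elim: rtrancl_on_leaves)
qed

context pair_graph
begin

lemma connected_leaves_arc:
  assumes "connected (with_proj G)" "S \<subseteq> pverts G" "S \<noteq> {}" "S \<noteq> pverts G"
  obtains s t where "s \<in> S" "t \<in> pverts G - S" "(s, t) \<in> parcs G"
proof -
  obtain s t where "s \<in> S" "t \<in> pverts G - S" "(s, t) \<in> (parcs G)\<^sup>s"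
    using connected_leaves[of "with_proj G" S] assms by auto
  then show thesis
    using that arcs_symmetric by (auto simp: symcl_def)
qed

lemma nbhd_leaves_arc:
  assumes "locally_connected G" "u \<in> pverts G" "S \<subseteq> nbhd G u" "S \<noteq> {}" "S \<noteq> nbhd G u"
  obtains s t where "s \<in> S" "t \<in> nbhd G u - S" "(s, t) \<in> parcs G"
proof -
  let ?H = "with_proj G \<restriction> nbhd G u"
  have "arcs_ends ?H \<subseteq> parcs G"
    by (auto simp: arcs_ends_def arc_to_ends_def)
  moreover have "connected ?H"
    using assms by (auto simp: locally_connected_def)
  then obtain s t where "s \<in> S" "t \<in> verts ?H - S" "(s, t) \<in> (arcs_ends ?H)\<^sup>s"
    using connected_leaves[of ?H S] assms(3-5) by auto
  ultimately show thesis
    using that arcs_symmetric by (auto simp: symcl_def)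
qed

lemma nbhd_nonempty:
  assumes "locally_connected G" "u \<in> pverts G"
  shows "nbhd G u \<noteq> {}"
  using assms by (auto simp: locally_connected_def connected_conv)

text \<open>Otherwise \<open>b\<close> has distance more than 2 from \<open>a\<close> in the
  connected graph induced on \<open>nbhd G u\<close>, so some vertex there has distance 3 from
  \<open>a\<close>, and a shortest path to it is an induced path of order 4.\<close>

lemma nbhd_common_neighbour:
  assumes lc: "locally_connected G" and free: "induced_free \<F> G" "K1_join_P4 \<in> \<F>"
    and u: "u \<in> pverts G"
    and ab: "a \<in> nbhd G u" "b \<in> nbhd G u" "a \<noteq> b" "(a, b) \<notin> parcs G"
  obtains c where "c \<in> nbhd G u" "(a, c) \<in> parcs G" "(c, b) \<in> parcs G"
proof (rule ccontr)
  assume "\<not> thesis"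
  then have no: "\<And>c. c \<in> nbhd G u \<Longrightarrow> (a, c) \<in> parcs G \<Longrightarrow> (c, b) \<notin> parcs G"
    using that by blast
  define N where "N = nbhd G u \<inter> nbhd G a"
  \<comment> \<open>The ball of radius 2 around \<open>a\<close> in the graph induced on
    \<open>nbhd G u\<close>.\<close>
  define S where "S = {a} \<union> N \<union> {d \<in> nbhd G u. \<exists>c \<in> N. (c, d) \<in> parcs G}"
  have "b \<notin> S"
    using no ab by (auto simp: S_def N_def nbhd_def)
  then have "S \<subseteq> nbhd G u" "S \<noteq> {}" "S \<noteq> nbhd G u"
    using ab by (auto simp: S_def N_def)
  then obtain s t where st: "s \<in> S" "t \<in> nbhd G u - S" "(s, t) \<in> parcs G"
    by (rule nbhd_leaves_arc[OF lc u])
  \<comment> \<open>Arcs inside \<open>nbhd G u\<close> from \<open>a\<close> end in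
    \<open>N\<close>, and those from \<open>N\<close> end in \<open>S\<close>; so \<open>s\<close>
    has distance exactly 2 from \<open>a\<close>.\<close>
  have "s \<noteq> a" "s \<notin> N"
    using st by (auto simp: S_def N_def nbhd_def)
  then obtain c where c: "c \<in> N" "(c, s) \<in> parcs G" "s \<in> nbhd G u"
    using st by (auto simp: S_def)
  have "distinct [a, c, s, t]"
    using c st \<open>s \<noteq> a\<close> \<open>s \<notin> N\<close> no_loops' by (auto simp: S_def N_def nbhd_def)
  then show False
    using c st \<open>s \<noteq> a\<close> \<open>s \<notin> N\<close> ab
    by (intro no_induced_P4_in_nbhd[OF free, of a c s t u]) (auto simp: S_def N_def nbhd_def)
qed

end

section \<open>Cycles as vertex lists\<close>

text \<open>Each vertex is listed once; prepending \<open>last vs\<close> makes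
  \<open>successively\<close> cover the closing arc too. Rotating, inserting and reversing become
  plain list operations.\<close>

definition vertex_cycle :: "'a rel \<Rightarrow> 'a list \<Rightarrow> bool" where
  "vertex_cycle E vs \<longleftrightarrow>
     distinct vs \<and> 3 \<le> length vs \<and> successively (\<lambda>u v. (u, v) \<in> E) (last vs # vs)"

lemma vertex_cycle_rotate:
  assumes "vertex_cycle E (xs @ ys)"
  shows "vertex_cycle E (ys @ xs)"
  using assms
  by (cases "xs = []"; cases "ys = []")
     (auto simp: vertex_cycle_def successively_Cons successively_append_iff)

text \<open>The closing arc is replaced by a detour through \<open>x\<close>. Any other arc can be
  made the closing one by \<open>vertex_cycle_rotate\<close>.\<close>

lemma vertex_cycle_insert:
  assumes "vertex_cycle E vs" "x \<notin> set vs" "(last vs, x) \<in> E" "(x, hd vs) \<in> E"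
  shows "vertex_cycle E (x # vs)"
  using assms by (cases vs) (auto simp: vertex_cycle_def successively_Cons)

text \<open>The rerouting \<open>u x y \<dots> u\<^sup>+ y\<^sup>+ \<dots> u\<close>, where \<open>u\<close> is the last vertex of the list.\<close>

lemma vertex_cycle_reroute:
  assumes "sym E" "vertex_cycle E (as @ bs)" "as \<noteq> []" "bs \<noteq> []" "x \<notin> set (as @ bs)"
    and "(last bs, x) \<in> E" "(x, last as) \<in> E" "(hd as, hd bs) \<in> E"
  shows "vertex_cycle E (x # rev as @ bs)"
proof -
  have "(v, u) \<in> E \<longleftrightarrow> (u, v) \<in> E" for u v
    using \<open>sym E\<close> by (auto dest: symD)
  \<comment> \<open>Symmetry of \<open>E\<close> allows the segment \<open>as\<close> to be
    traversed backwards.\<close>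
  then have "successively (\<lambda>u v. (u, v) \<in> E) (rev as) \<longleftrightarrow> successively (\<lambda>u v. (u, v) \<in> E) as"
    by simp
  then show ?thesis
    using assms
    by (auto simp: vertex_cycle_def successively_Cons successively_append_iff hd_rev last_rev
        hd_append simp del: successively_rev)
qed

section \<open>Translation between vertex lists and arc lists\<close>

lemma successively_conv_vwalk_arcs:
  "successively (\<lambda>u v. (u, v) \<in> E) vs \<longleftrightarrow> set (vwalk_arcs vs) \<subseteq> E"
  by (induction vs rule: vwalk_arcs.induct) auto

lemma vwalk_arcs_pawalk_verts: "pcas u p v \<Longrightarrow> vwalk_arcs (pawalk_verts u p) = p"
proof (induction p arbitrary: u)
  case (Cons e p)
  then show ?case by (cases p) auto
qed simp

lemma pawalk_verts_vwalk_arcs: "vs \<noteq> [] \<Longrightarrow> pawalk_verts (hd vs) (vwalk_arcs vs) = vs"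
  by (induction vs rule: vwalk_arcs.induct) auto

lemma pcas_vwalk_arcs: "vs \<noteq> [] \<Longrightarrow> pcas (hd vs) (vwalk_arcs vs) (last vs)"
  by (induction vs rule: vwalk_arcs.induct) auto

lemma length_pawalk_verts: "length (pawalk_verts u p) = Suc (length p)"
  by (induction p arbitrary: u) auto

lemma last_pawalk_verts: "pcas u p v \<Longrightarrow> last (pawalk_verts u p) = v"
  by (induction p arbitrary: u) (auto, (metis pawalk_verts.simps list.exhaust list.distinct(1))+)

lemma fst_vwalk_arcs: "fst ` set (vwalk_arcs vs) = set (butlast vs)"
  by (induction vs rule: vwalk_arcs.induct) auto

lemma set_butlast_last_Cons: "vs \<noteq> [] \<Longrightarrow> set (butlast (last vs # vs)) = set vs"
  by (metis append_butlast_last_id butlast.simps(2) list.set(2) rotate1.simps(2) set_rotate1)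

context pair_graph
begin

lemma graph_cycle_imp_vertex_cycle:
  assumes "graph_cycle G C"
  obtains vs where "vertex_cycle (parcs G) vs" "set vs = cycle_verts C"
proof -
  obtain u where u: "set C \<subseteq> parcs G" "pcas u C u" "distinct (tl (pawalk_verts u C))" "3 \<le> length C"
    using assms by (auto simp: graph_cycle_def cycle_def awalk_def)
  \<comment> \<open>The vertex list of the closed walk has its base point \<open>u\<close> at both
    ends; dropping the first occurrence leaves every vertex once, with \<open>u\<close>
    last.\<close>
  define vs where "vs = tl (pawalk_verts u C)"
  have "length vs = length C"
    unfolding vs_def by (simp add: length_pawalk_verts)
  then have "vs \<noteq> []" using u by auto
  moreover have "pawalk_verts u C = u # vs"
    using u by (cases C) (auto simp: vs_def)
  ultimately have "pawalk_verts u C = last vs # vs"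
    using last_pawalk_verts[OF u(2)] by simp
  then have C: "vwalk_arcs (last vs # vs) = C"
    using vwalk_arcs_pawalk_verts[OF u(2)] by simp
  have "distinct vs" "3 \<le> length vs"
    using u \<open>length vs = length C\<close> by (simp_all add: vs_def)
  then have "vertex_cycle (parcs G) vs"
    unfolding vertex_cycle_def successively_conv_vwalk_arcs C using u(1) by blast
  moreover have "cycle_verts C = set vs"
    unfolding cycle_verts_def C[symmetric] fst_vwalk_arcs set_butlast_last_Cons[OF \<open>vs \<noteq> []\<close>] ..
  ultimately show thesis using that by blast
qed

lemma vertex_cycle_imp_graph_cycle:
  assumes "vertex_cycle (parcs G) vs"
  obtains C where "graph_cycle G C" "cycle_verts C = set vs"
proof -
  let ?C = "vwalk_arcs (last vs # vs)"
  have vs: "vs \<noteq> []" "set ?C \<subseteq> parcs G" "distinct vs" "3 \<le> length vs"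
    using assms by (auto simp: vertex_cycle_def successively_conv_vwalk_arcs)
  have "pcas (last vs) ?C (last vs)"
    using pcas_vwalk_arcs[of "last vs # vs"] vs by simp
  moreover have "pawalk_verts (last vs) ?C = last vs # vs"
    using pawalk_verts_vwalk_arcs[of "last vs # vs"] by simp
  \<comment> \<open>The closing arc lies in \<open>parcs G\<close>, so the base point
    \<open>last vs\<close> is a vertex of \<open>G\<close>, as \<open>awalk\<close> demands.\<close>
  moreover have "?C \<noteq> []" "(last vs, hd vs) \<in> set ?C"
    using vs by auto
  moreover have "length ?C = length vs"
    using vwalk_length_simp[of "last vs # vs"] by (simp only: vwalk_length_def) simp
  ultimately have "graph_cycle G ?C"
    unfolding graph_cycle_def cycle_def awalk_def using vs in_arcsD1
    by (metis list.sel(3) subsetD)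
  moreover have "cycle_verts ?C = set vs"
    unfolding cycle_verts_def by (simp only: fst_vwalk_arcs set_butlast_last_Cons[OF vs(1)])
  ultimately show thesis using that by blast
qed

section \<open>Triangles and cycle extension\<close>

text \<open>For an edge from \<open>u\<close> to \<open>v\<close>, order at least 3 gives an edge
  leaving \<open>{u, v}\<close>. So one end has a neighbour besides the other end, and connectedness
  of its neighbourhood makes the other end adjacent to a vertex there, which closes a
  triangle.\<close>

lemma lies_on_triangle:
  assumes con: "connected (with_proj G)" and lc: "locally_connected G"
    and card: "3 \<le> card (pverts G)" and u: "u \<in> pverts G"
  obtains v w where "vertex_cycle (parcs G) [u, v, w]"
proof -
  obtain v where v: "(u, v) \<in> parcs G"
    using nbhd_nonempty[OF lc u] by (auto simp: nbhd_def)
  then have vG: "v \<in> pverts G" by (rule in_arcsD2)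
  have "card {u, v} \<le> 2" by (simp add: card_insert_if)
  then have "{u, v} \<noteq> pverts G" using card by auto
  then obtain s t where st: "s \<in> {u, v}" "t \<in> pverts G - {u, v}" "(s, t) \<in> parcs G"
    using connected_leaves_arc[OF con, of "{u, v}"] u vG by auto
  have "\<exists>w. (u, w) \<in> parcs G \<and> (v, w) \<in> parcs G"
  proof (cases "s = u")
    case True
    then have "{v} \<subseteq> nbhd G u" "{v} \<noteq> nbhd G u"
      using st v by (auto simp: nbhd_def)
    then show ?thesis
      using nbhd_leaves_arc[OF lc u, of "{v}"] by (auto simp: nbhd_def)
  next
    case False
    then have "{u} \<subseteq> nbhd G v" "{u} \<noteq> nbhd G v"
      using st v arcs_symmetric by (auto simp: nbhd_def)
    then show ?thesis
      using nbhd_leaves_arc[OF lc vG, of "{u}"] by (auto simp: nbhd_def)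
  qed
  then obtain w where "(u, w) \<in> parcs G" "(v, w) \<in> parcs G"
    by blast
  then have "vertex_cycle (parcs G) [u, v, w]"
    using v arcs_symmetric no_loops' by (auto simp: vertex_cycle_def)
  then show thesis using that by blast
qed

lemma vertex_cycle_extend:
  assumes con: "connected (with_proj G)" and lc: "locally_connected G"
    and free: "induced_free \<F> G" and K113: "K113 \<in> \<F>" and P4: "K1_join_P4 \<in> \<F>"
    and cyc: "vertex_cycle (parcs G) vs0" and ne: "set vs0 \<noteq> pverts G"
  obtains vs' x where "vertex_cycle (parcs G) vs'" "x \<notin> set vs0" "set vs' = insert x (set vs0)"
proof (rule ccontr)
  note extension = that
  assume "\<not> thesis"
  have max: False if "vertex_cycle (parcs G) vs'" "x \<notin> set vs0" "set vs' = insert x (set vs0)"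
    for vs' x
    using that extension \<open>\<not> thesis\<close> by blast
  have sym: "(s, t) \<in> parcs G \<longleftrightarrow> (t, s) \<in> parcs G" for s t
    using arcs_symmetric by blast
  have symE: "sym (parcs G)"
    using arcs_symmetric by (auto intro: symI)
  have noloop: "(s, s) \<notin> parcs G" for s
    using no_loops' by blast
  \<comment> \<open>\<open>vertex_cycle\<close> only constrains arcs; that the listed vertices
    belong to \<open>pverts G\<close> is read off from the arcs of \<open>C\<close>.\<close>
  obtain C where C: "graph_cycle G C" "cycle_verts C = set vs0"
    using vertex_cycle_imp_graph_cycle[OF cyc] .
  then have "set vs0 \<subseteq> pverts G"
    using in_arcsD1 by (fastforce simp: graph_cycle_def cycle_def awalk_def cycle_verts_def)
  moreover have "set vs0 \<noteq> {}"
    using cyc by (auto simp: vertex_cycle_def)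
  ultimately obtain u x where ux: "u \<in> set vs0" "x \<in> pverts G - set vs0" "(u, x) \<in> parcs G"
    using connected_leaves_arc[OF con, of "set vs0"] ne by blast
  then obtain xs ys where "vs0 = xs @ u # ys"
    by (meson split_list)
  \<comment> \<open>Rotated so that \<open>u\<close> comes last; its successor is then the head of
    the list.\<close>
  define vs where "vs = ys @ xs @ [u]"
  have vs: "vertex_cycle (parcs G) vs" "set vs = set vs0" "last vs = u"
    using vertex_cycle_rotate[of "parcs G" "xs @ [u]" ys] cyc \<open>vs0 = xs @ u # ys\<close>
    by (auto simp: vs_def)
  note max = max[folded vs(2)]
  have xvs: "x \<notin> set vs" using ux vs by simp
  have uG: "u \<in> pverts G" using ux in_arcsD1 by blast
  define u' where "u' = hd vs"
  have u': "(u, u') \<in> parcs G" "u' \<in> set vs" "u' \<noteq> x"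
    using vs xvs by (cases vs; auto simp: vertex_cycle_def u'_def)+
  \<comment> \<open>For \<open>x\<close> this will show that \<open>x\<close> and \<open>u'\<close>
    are nonadjacent, for \<open>y\<close> that \<open>y\<close> lies on the cycle.\<close>
  have insert_u: "\<not> ((u, z) \<in> parcs G \<and> (z, u') \<in> parcs G)" if "z \<notin> set vs" for z
    using max[OF vertex_cycle_insert[OF vs(1) that], of z] vs that by (auto simp: u'_def)
  have xu': "(x, u') \<notin> parcs G"
    using insert_u[OF xvs] ux by blast
  obtain y where y: "(u, y) \<in> parcs G" "(x, y) \<in> parcs G" "(y, u') \<in> parcs G"
    using nbhd_common_neighbour[OF lc free P4 uG, of x u'] ux u' xu' by (auto simp: nbhd_def)
  have "y \<in> set vs"
    using insert_u y by blast
  then obtain as bs where asbs: "vs = as @ y # bs"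
    by (meson split_list)
  \<comment> \<open>As \<open>u\<close> is the last vertex, \<open>y\<close> is not, so its
    successor \<open>y'\<close> is the head of \<open>bs\<close> without wrapping around.\<close>
  have "y \<noteq> u" using y noloop by blast
  then have "bs \<noteq> []" using asbs vs(3) by auto
  then obtain y' bs' where bs: "bs = y' # bs'" by (cases bs) auto
  have yG: "y \<in> pverts G" and yy': "(y, y') \<in> parcs G"
    using y in_arcsD1 vs(1) asbs bs
    by (auto simp: vertex_cycle_def successively_Cons successively_append_iff)
  have xy': "(x, y') \<notin> parcs G"
  proof
    assume "(x, y') \<in> parcs G"
    \<comment> \<open>Rotated so that \<open>y\<close> comes last and \<open>x\<close> fits between
      \<open>y\<close> and \<open>y'\<close>.\<close>
    moreover have "vertex_cycle (parcs G) (bs @ as @ [y])"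
      using vertex_cycle_rotate[of "parcs G" "as @ [y]" bs] vs(1) asbs by simp
    ultimately have "vertex_cycle (parcs G) (x # bs @ as @ [y])"
      using xvs asbs bs y sym by (intro vertex_cycle_insert) auto
    from max[OF this, of x] show False
      using xvs asbs by auto
  qed
  have u'y': "(u', y') \<notin> parcs G"
  proof
    assume "(u', y') \<in> parcs G"
    then have "vertex_cycle (parcs G) (x # rev (as @ [y]) @ bs)"
      using vs ux y sym xvs asbs bs
      by (intro vertex_cycle_reroute[OF symE]) (auto simp: u'_def hd_append)
    from max[OF this, of x] show False
      using xvs asbs by auto
  qed
  have ind: "distinct [x, u', y']"
    using u' xvs asbs bs vs(1) y noloop
    by (cases as) (auto simp: u'_def vertex_cycle_def)
  \<comment> \<open>Otherwise \<open>x\<close>, \<open>u'\<close>, \<open>y'\<close> would be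
    independent common neighbours of the adjacent \<open>u\<close> and \<open>y\<close>.\<close>
  have "(u, y') \<notin> parcs G"
    using no_induced_K113[OF free K113 y(1) ind] ux u' y yy' xu' xy' u'y' sym
    by (auto simp: nbhd_def)
  have "x \<in> nbhd G y" "y' \<in> nbhd G y"
    using y yy' sym by (auto simp: nbhd_def)
  then obtain w where w: "(y, w) \<in> parcs G" "(x, w) \<in> parcs G" "(w, y') \<in> parcs G"
    using nbhd_common_neighbour[OF lc free P4 yG, of x y'] ind xy' by (auto simp: nbhd_def)
  have "(u, w) \<in> parcs G"
  proof (rule ccontr)
    assume "(u, w) \<notin> parcs G"
    \<comment> \<open>The other possible chords, from \<open>u\<close> to \<open>y'\<close> and from
      \<open>x\<close> to \<open>y'\<close>, are already excluded.\<close>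
    then show False
      using no_induced_P4_in_nbhd[OF free P4, of u x w y' y]
        ux y w yy' xy' \<open>(u, y') \<notin> parcs G\<close> sym noloop ind
      by (auto simp: nbhd_def)
  qed
  have "(u', w) \<in> parcs G"
  proof (rule ccontr)
    assume "(u', w) \<notin> parcs G"
    then show False
      using no_induced_P4_in_nbhd[OF free P4, of u' u w y' y]
        ux u' y w yy' xu' u'y' xy' \<open>(u, y') \<notin> parcs G\<close> \<open>(u, w) \<in> parcs G\<close> sym noloop ind
      by (auto simp: nbhd_def)
  qed
  then show False
    using no_induced_K113[OF free K113 w(1) ind] y w yy' xu' xy' u'y' sym
    by (auto simp: nbhd_def)
qed

end

theorem theorem6:
  fixes G :: "'a pair_pre_digraph"
  assumes "pair_graph G"
    and "Digraph_Component.connected (with_proj G)"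
    and "locally_connected G"
    and "induced_free {K113, K1_join_P4} G"
    and "3 \<le> card (pverts G)"
  shows "fully_cycle_extendable G"
proof -
  interpret pair_graph G by fact
  show ?thesis
    unfolding fully_cycle_extendable_def
  proof (intro conjI ballI allI impI)
    fix u
    assume "u \<in> pverts G"
    then obtain v w where vw: "vertex_cycle (parcs G) [u, v, w]"
      using lies_on_triangle assms by blast
    moreover obtain T where "graph_cycle G T" "cycle_verts T = set [u, v, w]"
      using vertex_cycle_imp_graph_cycle[OF vw] .
    ultimately show "\<exists>T. graph_cycle G T \<and> card (cycle_verts T) = 3 \<and> u \<in> cycle_verts T"
      using distinct_card[of "[u, v, w]"] by (auto simp: vertex_cycle_def)
  next
    fix C
    assume C: "graph_cycle G C \<and> card (cycle_verts C) < card (pverts G)"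
    then obtain vs where vs: "vertex_cycle (parcs G) vs" "set vs = cycle_verts C"
      using graph_cycle_imp_vertex_cycle by blast
    then have "set vs \<noteq> pverts G" using C by auto
    then obtain vs' x where vs': "vertex_cycle (parcs G) vs'" "x \<notin> set vs" "set vs' = insert x (set vs)"
      using vertex_cycle_extend[OF assms(2-4) _ _ vs(1)] by blast
    moreover obtain C' where "graph_cycle G C'" "cycle_verts C' = set vs'"
      using vertex_cycle_imp_graph_cycle[OF vs'(1)] .
    \<comment> \<open>Exactly one new vertex \<open>x\<close> was added, so the cardinality grows by
      exactly 1.\<close>
    ultimately show "extendable G C"
      unfolding extendable_def using vs
      by (metis List.finite_set Suc_eq_plus1 card_insert_disjoint subset_insertI)
  qed
qed

end
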